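(* Consider a resource allocation problem with resources $R=\{1,\dots,N\}$ of capacities $c_j\ge 0$, demands $D=\{1,\dots,M\}$ of magnitudes $w_i\ge 0$, and incidence sets $D_j\subseteq D$, $R_i\subseteq R$ with $i\in D_j \iff j\in R_i$. Run the REACT bidder algorithm for every demand $i\in D$ and the REACT auctioneer algorithm for every resource $j\in R$ (both defined in the context), in the asynchronous model of the context: the problem data stay constant, bidder $i$ knows $R_i$ and $w_i$, auctioneer $j$ knows $D_j$ and $c_j$, and no message between an adjacent bidder and auctioneer is delayed indefinitely. Then the bidders and auctioneers compute the lexicographic max-min allocation: after a finite time all claims are stable (they no longer change), and the vector $\boldsymbol{s}=(s_1,\dots,s_M)$, where $s_i$ is the final claim of bidder $i$, is a lexicographically max-min allocation.
   Context: **Resource allocation problem.** $R$ is a set of $N$ resources with capacities $\boldsymbol c=(c_1,\dots,c_N)$; $D$ is a set of $M$ demands with magnitudes $\boldsymbol w=(w_1,\dots,w_M)$. Resource $j$ is required by the demands in $D_j\subseteq D$; demand $i$ consumes capacity at all resources in $R_i\subseteq R$ simultaneously ($i\in D_j\iff j\in R_i$; then $i$ and $j$ are called adjacent). An allocation is $\boldsymbol s=(s_1,\dots,s_M)$ with $s_i\ge 0$. It is feasible if $\sum_{i\in D_j}s_i\le c_j$ for all $j\in R$ and $s_i\le w_i$ for all $i\in D$. Demand $i$ is satisfied if $s_i\ge w_i$. Resource $j$ is saturated if $\sum_{i\in D_j}s_i\ge c_j$. A feasible allocation $\boldsymbol s$ is lexicographically max-min if for every $i\in D$, either $i$ is satisfied,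 or there is a saturated resource $j$ with $i\in D_j$ and $s_i=\max\{s_k: k\in D_j\}$. **REACT bidder for demand $i$.** It stores, for each $j\in R_i$, the value $\mathrm{offers}[j]$ last received from auctioneer $j$. Whenever it receives its inputs ($w_i$, $R_i$) or receives an offer from an auctioneer (after storing it), it executes UpdateClaim: set $$\mathrm{claim}_i:=\min\big(\{\mathrm{offers}[j]: j\in R_i\}\cup\{w_i\}\big)$$ and send $\mathrm{claim}_i$ to all auctioneers in $R_i$. **REACT auctioneer for resource $j$.** It stores, for each $i\in D_j$, the value $\mathrm{claims}[i]$ last received from bidder $i$. Whenever it receives its inputs ($c_j$, $D_j$) or receives a claim from a bidder (after storing it), it executes UpdateOffer: 1. Set $D_j^*:=\emptyset$, $A_j:=c_j$. 2. If $D_j^*=D_j$, set $\mathrm{offer}_j:=A_j+\max\{\mathrm{claims}[i]: i\in D_j\}$ (with $\max\emptyset:=0$) and go to step 4. 3. Otherwise set $\mathrm{offer}_j:=A_j/|D_j\setminus D_j^*|$. Let $B:=\{b\in D_j\setminus D_j^*:\ \mathrm{claims}[b]<\mathrm{offer}_j\}$. If $B=\emptyset$ go to step 4; otherwise replace $D_j^*$ by $D_j^*\cup B$, replace $A_j$ by $A_j-\sum_{b\in B}\mathrm{claims}[b]$, and return to step 2. 4. Send $\mathrm{offer}_j$ to all bidders in $D_j$. **Execution model.** The data $R_i,D_j,w_i,c_j$ are constant during the whole period considered. At the start of the period each bidder $i$ has received $R_i,w_i$ and executes UpdateClaim, and each auctioneer $j$ has received $D_j,c_j$ and executes UpdateOffer;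 the stored values $\mathrm{offers}[\cdot]$, $\mathrm{claims}[\cdot]$ at that moment are arbitrary nonnegative reals, and finitely many messages carrying nonnegative values may be in transit. Processing is asynchronous: delays are arbitrary, but every message sent between an adjacent bidder and auctioneer is received after a finite time, and only finitely many events occur in any bounded time interval. A claim or offer is stable (from some time on) if it has reached its final value, i.e. it does not change any more. *)

theory Defs
  imports Complex_Main "HOL-Library.Multiset"
begin

section \<open>Resource allocation problems\<close>

record ('r, 'd) problem =
  resources :: "'r set"
  demands :: "'d set"
  capacity :: "'r \<Rightarrow> real"
  magnitude :: "'d \<Rightarrow> real"
  demands_at :: "'r \<Rightarrow> 'd set"
  resources_of :: "'d \<Rightarrow> 'r set"

definition resource_allocation_problem :: "('r, 'd) problem \<Rightarrow> bool" where
  "resource_allocation_problem P \<longleftrightarrow>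
     finite (resources P) \<and> finite (demands P) \<and>
     (\<forall>j\<in>resources P. capacity P j \<ge> 0) \<and>
     (\<forall>i\<in>demands P. magnitude P i \<ge> 0) \<and>
     (\<forall>j\<in>resources P. demands_at P j \<subseteq> demands P) \<and>
     (\<forall>i\<in>demands P. resources_of P i \<subseteq> resources P) \<and>
     (\<forall>i\<in>demands P. \<forall>j\<in>resources P. i \<in> demands_at P j \<longleftrightarrow> j \<in> resources_of P i)"

definition adjacent :: "('r, 'd) problem \<Rightarrow> 'd \<Rightarrow> 'r \<Rightarrow> bool" where
  "adjacent P i j \<longleftrightarrow> i \<in> demands P \<and> j \<in> resources P \<and> i \<in> demands_at P j"

definition allocation :: "('r, 'd) problem \<Rightarrow> ('d \<Rightarrow> real) \<Rightarrow> bool" where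
  "allocation P s \<longleftrightarrow> (\<forall>i\<in>demands P. s i \<ge> 0)"

definition feasible :: "('r, 'd) problem \<Rightarrow> ('d \<Rightarrow> real) \<Rightarrow> bool" where
  "feasible P s \<longleftrightarrow>
     allocation P s \<and>
     (\<forall>j\<in>resources P. (\<Sum>i\<in>demands_at P j. s i) \<le> capacity P j) \<and>
     (\<forall>i\<in>demands P. s i \<le> magnitude P i)"

definition satisfied :: "('r, 'd) problem \<Rightarrow> ('d \<Rightarrow> real) \<Rightarrow> 'd \<Rightarrow> bool" where
  "satisfied P s i \<longleftrightarrow> s i \<ge> magnitude P i"

definition saturated :: "('r, 'd) problem \<Rightarrow> ('d \<Rightarrow> real) \<Rightarrow> 'r \<Rightarrow> bool" where
  "saturated P s j \<longleftrightarrow> (\<Sum>i\<in>demands_at P j. s i) \<ge> capacity P j"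

definition lex_max_min :: "('r, 'd) problem \<Rightarrow> ('d \<Rightarrow> real) \<Rightarrow> bool" where
  "lex_max_min P s \<longleftrightarrow>
     feasible P s \<and>
     (\<forall>i\<in>demands P.
        satisfied P s i \<or>
        (\<exists>j\<in>resources P. saturated P s j \<and> i \<in> demands_at P j \<and>
           s i = Max (s ` demands_at P j)))"

section \<open>The REACT bidder and auctioneer\<close>

definition bidder_claim :: "('r, 'd) problem \<Rightarrow> 'd \<Rightarrow> ('r \<Rightarrow> real) \<Rightarrow> real" where
  "bidder_claim P i offs = Min (offs ` resources_of P i \<union> {magnitude P i})"

text \<open>The loop by which an auctioneer computes its offer; \<open>Dj\<close> and \<open>cl\<close> are the demands at the resource
  and the stored claims, \<open>Ds\<close> and \<open>A\<close> the current values of the set \<open>D\<^sub>j\<^sup>*\<close>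
  of demands already settled below the offer and of the capacity \<open>A\<^sub>j\<close> they leave. It terminates for
  finite \<open>Dj\<close>, since \<open>Ds\<close> grows strictly inside \<open>Dj\<close>.\<close>

partial_function (tailrec) offer_loop ::
    "'d set \<Rightarrow> ('d \<Rightarrow> real) \<Rightarrow> 'd set \<Rightarrow> real \<Rightarrow> real" where
  "offer_loop Dj cl Ds A =
     (if Ds = Dj then A + (if Dj = {} then 0 else Max (cl ` Dj))
      else let off = A / real (card (Dj - Ds)); B = {b \<in> Dj - Ds. cl b < off}
           in if B = {} then off else offer_loop Dj cl (Ds \<union> B) (A - (\<Sum>b\<in>B. cl b)))"

definition auctioneer_offer :: "('r, 'd) problem \<Rightarrow> 'r \<Rightarrow> ('d \<Rightarrow> real) \<Rightarrow> real" where
  "auctioneer_offer P j cl = offer_loop (demands_at P j) cl {} (capacity P j)"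

section \<open>Asynchronous executions\<close>

text \<open>\<open>Claim i j v\<close> is sent by bidder \<open>i\<close> to auctioneer \<open>j\<close>, \<open>Offer j i v\<close> by auctioneer \<open>j\<close> to
  bidder \<open>i\<close>.\<close>

datatype ('r, 'd) message = Claim 'd 'r real | Offer 'r 'd real

primrec msg_bidder :: "('r, 'd) message \<Rightarrow> 'd" where
  "msg_bidder (Claim i j v) = i"
| "msg_bidder (Offer j i v) = i"

primrec msg_auctioneer :: "('r, 'd) message \<Rightarrow> 'r" where
  "msg_auctioneer (Claim i j v) = j"
| "msg_auctioneer (Offer j i v) = j"

primrec msg_value :: "('r, 'd) message \<Rightarrow> real" where
  "msg_value (Claim i j v) = v"
| "msg_value (Offer j i v) = v"

text \<open>\<open>offers \<sigma> i j\<close> is the entry \<open>offers[j]\<close> of bidder \<open>i\<close>, and \<open>claims \<sigma> j i\<close> the entry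
  \<open>claims[i]\<close> of auctioneer \<open>j\<close>. Only entries of adjacent pairs are ever read. The messages in
  transit form a multiset: any of them may be delivered next, so channels need not preserve
  order.\<close>

record ('r, 'd) state =
  offers :: "'d \<Rightarrow> 'r \<Rightarrow> real"
  claims :: "'r \<Rightarrow> 'd \<Rightarrow> real"
  claim :: "'d \<Rightarrow> real"
  offer :: "'r \<Rightarrow> real"
  transit :: "('r, 'd) message multiset"

definition claim_messages :: "('r, 'd) problem \<Rightarrow> 'd \<Rightarrow> real \<Rightarrow> ('r, 'd) message multiset" where
  "claim_messages P i v = image_mset (\<lambda>j. Claim i j v) (mset_set (resources_of P i))"

definition offer_messages :: "('r, 'd) problem \<Rightarrow> 'r \<Rightarrow> real \<Rightarrow> ('r, 'd) message multiset" where
  "offer_messages P j v = image_mset (\<lambda>i. Offer j i v) (mset_set (demands_at P j))"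

definition update_claim :: "('r, 'd) problem \<Rightarrow> 'd \<Rightarrow> ('r, 'd) state \<Rightarrow> ('r, 'd) state" where
  "update_claim P i \<sigma> =
     (let v = bidder_claim P i (offers \<sigma> i)
      in \<sigma>\<lparr>claim := (claim \<sigma>)(i := v), transit := transit \<sigma> + claim_messages P i v\<rparr>)"

definition update_offer :: "('r, 'd) problem \<Rightarrow> 'r \<Rightarrow> ('r, 'd) state \<Rightarrow> ('r, 'd) state" where
  "update_offer P j \<sigma> =
     (let v = auctioneer_offer P j (claims \<sigma> j)
      in \<sigma>\<lparr>offer := (offer \<sigma>)(j := v), transit := transit \<sigma> + offer_messages P j v\<rparr>)"

primrec receive :: "('r, 'd) problem \<Rightarrow> ('r, 'd) message \<Rightarrow> ('r, 'd) state \<Rightarrow> ('r, 'd) state" where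
  "receive P (Offer j i v) \<sigma> =
     update_claim P i
       (\<sigma>\<lparr>offers := (offers \<sigma>)(i := (offers \<sigma> i)(j := v)), transit := transit \<sigma> - {#Offer j i v#}\<rparr>)"
| "receive P (Claim i j v) \<sigma> =
     update_offer P j
       (\<sigma>\<lparr>claims := (claims \<sigma>)(j := (claims \<sigma> j)(i := v)), transit := transit \<sigma> - {#Claim i j v#}\<rparr>)"

text \<open>The situation just before the initial updates. Messages left over from earlier may be in
  transit between any bidder and auctioneer; one between a non-adjacent pair is harmless, as
  its value is stored in an entry that is never read.\<close>

definition admissible_start :: "('r, 'd) problem \<Rightarrow> ('r, 'd) state \<Rightarrow> bool" where
  "admissible_start P \<sigma> \<longleftrightarrow>
     (\<forall>i\<in>demands P. \<forall>j\<in>resources P. offers \<sigma> i j \<ge> 0 \<and> claims \<sigma> j i \<ge> 0) \<and>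
     (\<forall>m\<in>#transit \<sigma>. msg_bidder m \<in> demands P \<and> msg_auctioneer m \<in> resources P \<and> msg_value m \<ge> 0)"

text \<open>All nodes perform their initial update. An update neither reads nor writes anything that
  another node's update depends on, so their order does not matter.\<close>

definition start :: "('r, 'd) problem \<Rightarrow> ('r, 'd) state \<Rightarrow> ('r, 'd) state" where
  "start P \<sigma> =
     \<sigma>\<lparr>claim := (\<lambda>i. bidder_claim P i (offers \<sigma> i)),
       offer := (\<lambda>j. auctioneer_offer P j (claims \<sigma> j)),
       transit := transit \<sigma>
         + (\<Sum>i\<in>demands P. claim_messages P i (bidder_claim P i (offers \<sigma> i)))
         + (\<Sum>j\<in>resources P. offer_messages P j (auctioneer_offer P j (claims \<sigma> j)))\<rparr>"

text \<open>Event \<open>n\<close> takes place at time \<open>t n\<close> and leads from \<open>\<sigma> n\<close> to \<open>\<sigma> (Suc n)\<close>: either message \<open>m\<close>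
  is received (\<open>ev n = Some m\<close>), or nothing happens (\<open>ev n = None\<close>), so that a run with only
  finitely many receptions is also covered. Equal messages in transit are indistinguishable; the
  last condition applied repeatedly yields the reception of every copy.\<close>

definition execution ::
    "('r, 'd) problem \<Rightarrow> (nat \<Rightarrow> ('r, 'd) state) \<Rightarrow> (nat \<Rightarrow> ('r, 'd) message option) \<Rightarrow>
     (nat \<Rightarrow> real) \<Rightarrow> bool" where
  "execution P \<sigma> ev t \<longleftrightarrow>
     (\<exists>\<sigma>0. admissible_start P \<sigma>0 \<and> \<sigma> 0 = start P \<sigma>0) \<and>
     (\<forall>n. case ev n of
        None \<Rightarrow> \<sigma> (Suc n) = \<sigma> n
      | Some m \<Rightarrow> m \<in># transit (\<sigma> n) \<and> \<sigma> (Suc n) = receive P m (\<sigma> n)) \<and>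
     (\<forall>n. t n \<ge> 0) \<and> mono t \<and> (\<forall>T. finite {n. t n \<le> T}) \<and>
     (\<forall>n. \<forall>m\<in>#transit (\<sigma> n).
        adjacent P (msg_bidder m) (msg_auctioneer m) \<longrightarrow> (\<exists>k\<ge>n. ev k = Some m))"

text \<open>The state at time \<open>T\<close>, when exactly the events with \<open>t n \<le> T\<close> have taken place. As \<open>t\<close> is
  monotone, these are the first \<open>card {n. t n \<le> T}\<close> events.\<close>

definition state_at ::
    "(nat \<Rightarrow> ('r, 'd) state) \<Rightarrow> (nat \<Rightarrow> real) \<Rightarrow> real \<Rightarrow> ('r, 'd) state" where
  "state_at \<sigma> t T = \<sigma> (card {n. t n \<le> T})"

end

theory Submission imports Defs begin

text \<open>An offer \<open>x\<close> of resource \<open>j\<close> either solves \<open>\<Sum> min (cl b) x = c\<^sub>j\<close>, or the stored claims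
  fit into the capacity and \<open>x\<close> exceeds the largest one by the slack. Suppose the claims of the
  demands in \<open>F\<close> have converged to values at most \<open>l\<close>, and \<open>l\<close> is feasible as a common value for all
  other demands. Then, once the claims of \<open>F\<close> have arrived, every offer made to another demand is at
  least \<open>l\<close>, hence so are the other claims. If \<open>l\<close> is raised until some magnitude or some capacity
  becomes tight, the demands it limits converge to \<open>l\<close> and join \<open>F\<close>: the protocol imitates
  water filling, and induction on \<open>F\<close> reaches all demands.\<close>

section \<open>The offer of an auctioneer\<close>

text \<open>The assumptions on \<open>Ds\<close> and \<open>A\<close> are the loop invariant:
  \<open>A\<close> is the capacity left by \<open>Ds\<close>, and every claim in \<open>Ds\<close>
  lies below the current quotient. If the loop stops with no new claim below \<open>off\<close>,
  then \<open>min (cl b) off\<close> is \<open>cl b\<close> on \<open>Ds\<close> and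
  \<open>off\<close> elsewhere, so the minima add up to \<open>c\<close>. If \<open>Ds\<close>
  becomes all of \<open>D\<close>, the remainder \<open>A\<close>, nonnegative by the invariant, is
  the slack.\<close>

lemma offer_loop_cases:
  assumes "finite D" and "D \<noteq> {}" and "Ds \<subseteq> D" and "A + sum cl Ds = c"
    and "Ds \<noteq> D \<Longrightarrow> \<forall>b\<in>Ds. cl b < A / real (card (D - Ds))"
    and "Ds = D \<Longrightarrow> A \<ge> 0"
  shows "(\<Sum>b\<in>D. min (cl b) (offer_loop D cl Ds A)) = c \<and> (\<exists>b\<in>D. offer_loop D cl Ds A \<le> cl b) \<or>
         sum cl D \<le> c \<and> offer_loop D cl Ds A = Max (cl ` D) + (c - sum cl D)"
  using assms(3-)
proof (induction "card (D - Ds)" arbitrary: Ds A rule: less_induct)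
  case less
  show ?case
  proof (cases "Ds = D")
    case True
    \<comment> \<open>Only the loop in the second disjunct, the one that applies here, is
      unfolded.\<close>
    then show ?thesis
      using less.prems assms(2) by (subst (3) offer_loop.simps) auto
  next
    case False
    define k where "k = card (D - Ds)"
    define off where "off = A / real k"
    define B where "B = {b \<in> D - Ds. cl b < off}"
    have fin: "finite Ds" "finite (D - Ds)" "finite B"
      using assms(1) less.prems(1) by (auto simp: B_def intro: finite_subset)
    have ne: "D - Ds \<noteq> {}" using False less.prems(1) by auto
    then have k: "k > 0" using fin by (simp add: k_def card_gt_0_iff)
    then have A: "A = real k * off" by (simp add: off_def)
    have below: "\<forall>b\<in>Ds. cl b < off"
      using less.prems(3)[OF False] by (simp add: off_def k_def)
    have loop: "offer_loop D cl Ds A =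
        (if B = {} then off else offer_loop D cl (Ds \<union> B) (A - sum cl B))"
      by (subst offer_loop.simps) (simp only: False if_False Let_def off_def k_def B_def)
    show ?thesis
    proof (cases "B = {}")
      case True
      then have above: "\<forall>b\<in>D - Ds. off \<le> cl b" by (auto simp: B_def not_less)
      have "(\<Sum>b\<in>D. min (cl b) off) = (\<Sum>b\<in>D - Ds. min (cl b) off) + (\<Sum>b\<in>Ds. min (cl b) off)"
        using assms(1) less.prems(1) by (rule sum.subset_diff[rotated])
      also have "(\<Sum>b\<in>D - Ds. min (cl b) off) = (\<Sum>b\<in>D - Ds. off)"
        using above by (intro sum.cong) auto
      also have "(\<Sum>b\<in>Ds. min (cl b) off) = sum cl Ds"
        using below by (intro sum.cong) auto
      finally have "(\<Sum>b\<in>D. min (cl b) off) = c"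
        using less.prems(2) A by (simp add: k_def)
      then show ?thesis using True above ne loop by auto
    next
      case B: False
      have BD: "B \<subseteq> D - Ds" by (auto simp: B_def)
      have "sum cl B < (\<Sum>b\<in>B. off)"
        using B fin by (intro sum_strict_mono) (auto simp: B_def)
      then have sumB: "sum cl B < real (card B) * off" by simp
      have diff: "D - (Ds \<union> B) = (D - Ds) - B" by auto
      have card: "card (D - (Ds \<union> B)) = k - card B"
        unfolding diff k_def using BD fin by (simp add: card_Diff_subset)
      have cardB: "card B \<le> k" "0 < card B"
        using BD fin B by (auto simp: k_def card_mono card_gt_0_iff)
      \<comment> \<open>Removing claims below the average leaves more than \<open>off\<close> for
        each remaining demand. The quotient therefore rises and stays above all claims set aside so
        far. If none remains, the left-over capacity is positive.\<close>
      have A': "(A - sum cl B) > real (k - card B) * off"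
        using sumB cardB A by (simp add: of_nat_diff algebra_simps)
      have "offer_loop D cl Ds A = offer_loop D cl (Ds \<union> B) (A - sum cl B)"
        using loop B by simp
      moreover have "(\<Sum>b\<in>D. min (cl b) (offer_loop D cl (Ds \<union> B) (A - sum cl B))) = c \<and>
            (\<exists>b\<in>D. offer_loop D cl (Ds \<union> B) (A - sum cl B) \<le> cl b) \<or>
         sum cl D \<le> c \<and>
            offer_loop D cl (Ds \<union> B) (A - sum cl B) = Max (cl ` D) + (c - sum cl D)"
      proof (rule less.hyps)
        show "card (D - (Ds \<union> B)) < card (D - Ds)"
          using card cardB by (simp add: k_def)
        show "Ds \<union> B \<subseteq> D" using BD less.prems(1) by auto
        have "sum cl (Ds \<union> B) = sum cl Ds + sum cl B"
          using fin BD by (intro sum.union_disjoint) auto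
        then show "A - sum cl B + sum cl (Ds \<union> B) = c" using less.prems(2) by simp
        show "\<forall>b\<in>Ds \<union> B. cl b < (A - sum cl B) / real (card (D - (Ds \<union> B)))" if "Ds \<union> B \<noteq> D"
        proof -
          have "card (D - (Ds \<union> B)) > 0"
            using that BD less.prems(1) assms(1) by (auto simp: card_gt_0_iff)
          then have "off < (A - sum cl B) / real (card (D - (Ds \<union> B)))"
            using A' card by (simp add: pos_less_divide_eq mult.commute)
          then show ?thesis using below by (auto simp: B_def)
        qed
        show "0 \<le> A - sum cl B" if "Ds \<union> B = D"
          using A' card that by simp
      qed
      ultimately show ?thesis by simp
    qed
  qed
qed

lemma auctioneer_offer_cases:
  fixes P :: "('r, 'd) problem"
  assumes "finite (demands_at P j)" and "demands_at P j \<noteq> {}"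
  obtains (exhausted) b where "b \<in> demands_at P j" and "auctioneer_offer P j cl \<le> cl b"
      and "(\<Sum>b\<in>demands_at P j. min (cl b) (auctioneer_offer P j cl)) = capacity P j"
    | (slack) "sum cl (demands_at P j) \<le> capacity P j"
      and "auctioneer_offer P j cl =
        Max (cl ` demands_at P j) + (capacity P j - sum cl (demands_at P j))"
  using offer_loop_cases[of "demands_at P j" "{}" "capacity P j" cl "capacity P j"] assms
  unfolding auctioneer_offer_def by auto

text \<open>Suppose the offer were some x < l. In the exhausted case the minima are bounded by the
  claims on \<open>F\<close> and by x elsewhere, which by \<open>room\<close> falls short of the
  capacity. In the slack case all claims are below l, and the slack is large enough to lift any
  single claim outside \<open>F\<close> to l; since it is added to the maximal claim, the offer
  reaches l.\<close>

lemma auctioneer_offer_ge: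
  fixes P :: "('r, 'd) problem"
  assumes fin: "finite (demands_at P j)" and rest: "demands_at P j - F \<noteq> {}"
    and low: "\<forall>i\<in>demands_at P j \<inter> F. cl i \<le> l"
    and room: "sum cl (demands_at P j \<inter> F) + real (card (demands_at P j - F)) * l \<le> capacity P j"
  shows "l \<le> auctioneer_offer P j cl"
proof (rule ccontr)
  define D x where "D = demands_at P j" and "x = auctioneer_offer P j cl"
  note [simp] = D_def[symmetric] x_def[symmetric]
  have finD: "finite D" and ne: "D \<noteq> {}" using fin rest by auto
  assume "\<not> l \<le> auctioneer_offer P j cl"
  then have x: "x < l" by simp
  have split: "sum f D = sum f (D \<inter> F) + sum f (D - F)" for f :: "'d \<Rightarrow> real"
    using finD by (rule sum.Int_Diff)
  from fin ne[unfolded D_def] show False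
  proof (cases rule: auctioneer_offer_cases[where cl = cl])
    case exhausted
    have "(\<Sum>b\<in>D. min (cl b) x) \<le> sum cl (D \<inter> F) + (\<Sum>b\<in>D - F. x)"
      unfolding split by (intro add_mono sum_mono) auto
    also have "(\<Sum>b\<in>D - F. x) < real (card (D - F)) * l"
      using x rest finD by (simp add: card_gt_0_iff)
    finally show False using exhausted room by simp
  next
    case slack
    obtain k where k: "k \<in> D - F" using rest by auto
    have Max: "cl b \<le> Max (cl ` D)" if "b \<in> D" for b using finD that by simp
    have small: "cl b \<le> l" if "b \<in> D" for b
      using Max[OF that] slack x by simp
    \<comment> \<open>All summands are nonnegative by \<open>small\<close>, so one of them is at
      most the sum, which \<open>room\<close> bounds by the slack.\<close>
    have "l - cl k \<le> (\<Sum>b\<in>D - F. l - cl b)"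
      using k finD small by (intro member_le_sum) auto
    then have "l - cl k \<le> capacity P j - sum cl D"
      using room split[of cl] by (simp add: sum_subtractf)
    then show False using Max[of k] k slack x by simp
  qed
qed

text \<open>Claims of at least l outside \<open>F\<close> already use up the capacity when cut off
  at l. An offer above l would require a claim above l: in the exhausted case because some claim
  reaches the offer, in the slack case because \<open>tight\<close> leaves no positive slack above
  the maximal claim. Such a claim belongs to a demand outside \<open>F\<close> and pushes the total
  over the capacity.\<close>

lemma auctioneer_offer_eq:
  fixes P :: "('r, 'd) problem"
  assumes fin: "finite (demands_at P j)" and rest: "demands_at P j - F \<noteq> {}"
    and low: "\<forall>i\<in>demands_at P j \<inter> F. cl i \<le> l"
    and high: "\<forall>i\<in>demands_at P j - F. l \<le> cl i"
    and tight: "sum cl (demands_at P j \<inter> F) + real (card (demands_at P j - F)) * l = capacity P j"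
  shows "auctioneer_offer P j cl = l"
proof (rule antisym)
  show "l \<le> auctioneer_offer P j cl"
    using fin rest low tight by (intro auctioneer_offer_ge) auto
  define D x where "D = demands_at P j" and "x = auctioneer_offer P j cl"
  note [simp] = D_def[symmetric] x_def[symmetric]
  have finD: "finite D" and ne: "D \<noteq> {}" using fin rest by auto
  have split: "sum f D = sum f (D \<inter> F) + sum f (D - F)" for f :: "'d \<Rightarrow> real"
    using finD by (rule sum.Int_Diff)
  \<comment> \<open>The cut-off y is the offer in the exhausted case and the maximal claim in the
    slack case.\<close>
  have strict: "real (card (D - F)) * l < (\<Sum>i\<in>D - F. min (cl i) y)"
    if "b \<in> D" "l < cl b" "l < y" for b y
  proof -
    have "b \<in> D - F" using that low by force
    then have "(\<Sum>i\<in>D - F. l) < (\<Sum>i\<in>D - F. min (cl i) y)"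
      using that low high finD by (intro sum_strict_mono_ex1) (auto intro!: bexI[of _ b])
    then show ?thesis by simp
  qed
  show "auctioneer_offer P j cl \<le> l"
  proof (rule ccontr)
    assume "\<not> ?thesis"
    then have x: "l < x" by simp
    from fin ne[unfolded D_def] show False
    proof (cases rule: auctioneer_offer_cases[where cl = cl])
      case (exhausted b)
      have "(\<Sum>i\<in>D \<inter> F. min (cl i) x) = sum cl (D \<inter> F)"
      proof (rule sum.cong)
        fix i assume "i \<in> D \<inter> F"
        then have "cl i \<le> l" using low by simp
        then show "min (cl i) x = cl i" using x by simp
      qed simp
      then show False
        using strict[of b x] exhausted x tight split[of "\<lambda>i. min (cl i) x"] by simp
    next
      case slack
      have "sum cl (D - F) \<ge> real (card (D - F)) * l"
        using sum_mono[of "D - F" "\<lambda>_. l" cl] high by simp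
      then have "x \<le> Max (cl ` D)" using slack tight split[of cl] by simp
      moreover have "Max (cl ` D) \<in> cl ` D" using finD ne by (intro Max_in) auto
      then obtain b where b: "b \<in> D" "Max (cl ` D) = cl b" by blast
      ultimately have "l < cl b" using x by simp
      then have "real (card (D - F)) * l < (\<Sum>i\<in>D - F. min (cl i) (Max (cl ` D)))"
        using strict b by simp
      also have "\<dots> \<le> sum cl (D - F)" by (intro sum_mono) simp
      finally show False using slack tight split[of cl] by simp
    qed
  qed
qed

section \<open>Message delivery\<close>

text \<open>No message satisfying \<open>B\<close> is added from \<open>n0\<close> on, so the number
  of those in transit never grows and drops at each delivery of one. Fairness forces such a delivery
  while any is left, so the number reaches 0 and remains there. Other messages may be sent
  freely.\<close>

lemma eventually_delivered:
  fixes T :: "nat \<Rightarrow> 'm multiset"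
  assumes step: "\<And>n. n \<ge> n0 \<Longrightarrow> case ev n of
      None \<Rightarrow> filter_mset B (T (Suc n)) = filter_mset B (T n)
    | Some m \<Rightarrow> m \<in># T n \<and> filter_mset B (T (Suc n)) = filter_mset B (T n - {#m#})"
    and fair: "\<And>n m. n \<ge> n0 \<Longrightarrow> m \<in># T n \<Longrightarrow> B m \<Longrightarrow> \<exists>k\<ge>n. ev k = Some m"
  shows "\<forall>\<^sub>F n in sequentially. \<forall>m\<in>#T n. \<not> B m"
proof -
  define f where "f n = size (filter_mset B (T n))" for n
  have dec: "f (Suc n) \<le> f n \<and> (\<forall>m. ev n = Some m \<longrightarrow> B m \<longrightarrow> f (Suc n) < f n)"
    if "n \<ge> n0" for n
  proof (cases "ev n")
    case None
    then show ?thesis using step[OF that] by (simp add: f_def)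
  next
    case (Some m)
    then have "f (Suc n) = size (filter_mset B (T n) - filter_mset B {#m#})" "m \<in># T n"
      using step[OF that] by (auto simp: f_def simp del: filter_mset_add_mset)
    moreover from this(2) have "m \<in># filter_mset B (T n)" if "B m" using that by simp
    ultimately show ?thesis using Some
      by (cases "B m") (auto simp: f_def intro!: size_Diff1_less size_Diff1_le)
  qed
  have mono: "f k \<le> f n" if "n0 \<le> n" "n \<le> k" for n k
    using that(2)
  proof (induction rule: dec_induct)
    case (step m)
    then show ?case using dec[of m] that(1) by simp
  qed simp
  have "\<exists>k\<ge>n. f k = 0" if "n \<ge> n0" for n
    using that
  proof (induction "f n" arbitrary: n rule: less_induct)
    case less
    show ?case
    proof (cases "f n = 0")
      case False
      then obtain m where "m \<in># T n" "B m"
        by (auto simp: f_def filter_mset_eq_mempty_iff)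
      then obtain k where k: "k \<ge> n" "ev k = Some m" using fair less.prems by blast
      then have "f (Suc k) < f n"
        using dec[of k] mono[of n k] less.prems \<open>B m\<close> by fastforce
      then show ?thesis using less.hyps[of "Suc k"] k less.prems
        by (meson Suc_leD le_SucI order_trans)
    qed auto
  qed
  then obtain k where "k \<ge> n0" "f k = 0" by blast
  then have "f n = 0" if "n \<ge> k" for n using mono[of k n] that by simp
  then show ?thesis
    unfolding eventually_sequentially f_def by (auto simp: filter_mset_eq_mempty_iff)
qed

section \<open>Invariants of a run and the traffic between adjacent nodes\<close>

locale react_execution =
  fixes P :: "('r, 'd) problem"
    and \<sigma> :: "nat \<Rightarrow> ('r, 'd) state"
    and ev :: "nat \<Rightarrow> ('r, 'd) message option"
    and t :: "nat \<Rightarrow> real"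
  assumes problem: "resource_allocation_problem P"
    and execution: "execution P \<sigma> ev t"
begin

lemma finite_demands_at: "j \<in> resources P \<Longrightarrow> finite (demands_at P j)"
  and finite_resources_of: "i \<in> demands P \<Longrightarrow> finite (resources_of P i)"
  using problem unfolding resource_allocation_problem_def by (meson finite_subset)+

lemma adjacentD:
  assumes "adjacent P i j"
  shows "i \<in> demands P" "j \<in> resources P" "i \<in> demands_at P j" "j \<in> resources_of P i"
    "finite (resources_of P i)" "finite (demands_at P j)"
  using assms problem finite_demands_at finite_resources_of
  unfolding adjacent_def resource_allocation_problem_def by auto

lemma idle: "ev n = None \<Longrightarrow> \<sigma> (Suc n) = \<sigma> n"
  and reception: "ev n = Some m \<Longrightarrow> m \<in># transit (\<sigma> n) \<and> \<sigma> (Suc n) = receive P m (\<sigma> n)"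
  and fairness: "m \<in># transit (\<sigma> n) \<Longrightarrow> adjacent P (msg_bidder m) (msg_auctioneer m) \<Longrightarrow>
    \<exists>k\<ge>n. ev k = Some m"
proof -
  have step: "case ev n of None \<Rightarrow> \<sigma> (Suc n) = \<sigma> n
      | Some m \<Rightarrow> m \<in># transit (\<sigma> n) \<and> \<sigma> (Suc n) = receive P m (\<sigma> n)"
    using execution unfolding execution_def by blast
  show "ev n = None \<Longrightarrow> \<sigma> (Suc n) = \<sigma> n"
    and "ev n = Some m \<Longrightarrow> m \<in># transit (\<sigma> n) \<and> \<sigma> (Suc n) = receive P m (\<sigma> n)"
    using step by simp_all
  show "m \<in># transit (\<sigma> n) \<Longrightarrow> adjacent P (msg_bidder m) (msg_auctioneer m) \<Longrightarrow>
      \<exists>k\<ge>n. ev k = Some m"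
    using execution unfolding execution_def by blast
qed

text \<open>\<open>start\<close> computes both fields at every node, and each event that overwrites
  a stored entry recomputes the field depending on it, so the fields are always functions of the
  stored values.\<close>

lemma claim_eq: "claim (\<sigma> n) i = bidder_claim P i (offers (\<sigma> n) i)"
  and offer_eq: "offer (\<sigma> n) j = auctioneer_offer P j (claims (\<sigma> n) j)"
proof -
  have "(\<forall>i. claim (\<sigma> n) i = bidder_claim P i (offers (\<sigma> n) i)) \<and>
    (\<forall>j. offer (\<sigma> n) j = auctioneer_offer P j (claims (\<sigma> n) j))"
  proof (induction n)
    case 0
    show ?case using execution unfolding execution_def start_def by auto
  next
    case (Suc n)
    show ?case
    proof (cases "ev n")
      case None
      then show ?thesis using Suc idle by simp
    next
      case (Some m)
      then show ?thesis using Suc reception[OF Some]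
        by (cases m) (auto simp: update_claim_def update_offer_def Let_def)
    qed
  qed
  then show "claim (\<sigma> n) i = bidder_claim P i (offers (\<sigma> n) i)"
    and "offer (\<sigma> n) j = auctioneer_offer P j (claims (\<sigma> n) j)" by auto
qed

text \<open>The value sent is expressed by the field after the event, so that a property of the
  field from some index on passes to every message sent from there on.\<close>

lemma transit_receive_Offer:
  assumes "ev n = Some (Offer j i v)"
  shows "transit (\<sigma> (Suc n)) =
    transit (\<sigma> n) - {#Offer j i v#} + claim_messages P i (claim (\<sigma> (Suc n)) i)"
  using reception[OF assms] by (simp add: update_claim_def Let_def)

lemma transit_receive_Claim:
  assumes "ev n = Some (Claim i j v)"
  shows "transit (\<sigma> (Suc n)) =
    transit (\<sigma> n) - {#Claim i j v#} + offer_messages P j (offer (\<sigma> (Suc n)) j)"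
  using reception[OF assms] by (simp add: update_offer_def Let_def)

lemma in_claim_messages:
  "adjacent P i j \<Longrightarrow> Claim i j v \<in># claim_messages P i v"
  and in_offer_messages: "adjacent P i j \<Longrightarrow> Offer j i v \<in># offer_messages P j v"
  using adjacentD by (auto simp: claim_messages_def offer_messages_def)

lemma Claim_sent:
  assumes "ev n = Some (Offer j i v)" and "adjacent P i j"
  shows "Claim i j (claim (\<sigma> (Suc n)) i) \<in># transit (\<sigma> (Suc n))"
  unfolding transit_receive_Offer[OF assms(1)]
  using in_claim_messages[OF assms(2)] by (simp only: union_iff simp_thms)

lemma Offer_sent:
  assumes "ev n = Some (Claim i j v)" and "adjacent P i j"
  shows "Offer j i (offer (\<sigma> (Suc n)) j) \<in># transit (\<sigma> (Suc n))"
  unfolding transit_receive_Claim[OF assms(1)]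
  using in_offer_messages[OF assms(2)] by (simp only: union_iff simp_thms)

text \<open>Receiving a claim triggers an offer on the same edge, and receiving an offer triggers a
  claim. A message thus leaves the edge only by being answered on it, and the initial claim starts
  the exchange.\<close>

lemma edge_never_silent:
  assumes adj: "adjacent P i j"
  shows "\<exists>m\<in>#transit (\<sigma> n). msg_bidder m = i \<and> msg_auctioneer m = j"
proof (induction n)
  case 0
  obtain \<sigma>0 where \<sigma>0: "\<sigma> 0 = start P \<sigma>0" using execution unfolding execution_def by auto
  let ?v = "bidder_claim P i (offers \<sigma>0 i)"
  have "finite (demands P)" using problem unfolding resource_allocation_problem_def by simp
  then have "Claim i j ?v \<in># transit (\<sigma> 0)"
    unfolding \<sigma>0 start_def using in_claim_messages[OF adj] adjacentD(1)[OF adj]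
    by (auto simp: set_mset_sum)
  then show ?case by force
next
  case (Suc n)
  then obtain m where m: "m \<in># transit (\<sigma> n)" "msg_bidder m = i" "msg_auctioneer m = j" by blast
  show ?case
  proof (cases "ev n")
    case None
    then show ?thesis using Suc idle by simp
  next
    case (Some m')
    show ?thesis
    proof (cases "m' = m")
      case True
      show ?thesis
      proof (cases m)
        case (Claim i' j' v)
        then have "Offer j i (offer (\<sigma> (Suc n)) j) \<in># transit (\<sigma> (Suc n))"
          using Some True m adj by (auto intro: Offer_sent)
        then show ?thesis by force
      next
        case (Offer j' i' v)
        then have "Claim i j (claim (\<sigma> (Suc n)) i) \<in># transit (\<sigma> (Suc n))"
          using Some True m adj by (auto intro: Claim_sent)
        then show ?thesis by force
      qed
    next
      case False
      then have "m \<in># transit (\<sigma> n) - {#m'#}" using m by (simp add: in_diff_count)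
      then have "m \<in># transit (\<sigma> (Suc n))"
        using Some transit_receive_Claim transit_receive_Offer by (cases m') auto
      then show ?thesis using m by blast
    qed
  qed
qed

text \<open>Some message on the edge gets delivered. If it is a claim, the offer sent in reply is
  delivered later.\<close>

lemma Offer_received:
  assumes adj: "adjacent P i j"
  shows "\<exists>k\<ge>n. \<exists>v. ev k = Some (Offer j i v)"
proof -
  obtain m where m: "m \<in># transit (\<sigma> n)" "msg_bidder m = i" "msg_auctioneer m = j"
    using edge_never_silent[OF adj] by blast
  then obtain k where k: "k \<ge> n" "ev k = Some m" using fairness adj by blast
  show ?thesis
  proof (cases m)
    case (Claim i' j' v)
    then have "Offer j i (offer (\<sigma> (Suc k)) j) \<in># transit (\<sigma> (Suc k))"
      using k m adj by (auto intro: Offer_sent)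
    from fairness[OF this] adj obtain k' where
      "k' \<ge> Suc k" "ev k' = Some (Offer j i (offer (\<sigma> (Suc k)) j))" by auto
    then show ?thesis using k by (meson Suc_leD order_trans)
  qed (use k m in auto)
qed

lemma Claim_received:
  assumes adj: "adjacent P i j"
  shows "\<exists>k\<ge>n. \<exists>v. ev k = Some (Claim i j v)"
proof -
  obtain k v where k: "k \<ge> n" "ev k = Some (Offer j i v)" using Offer_received[OF adj] by blast
  then have "Claim i j (claim (\<sigma> (Suc k)) i) \<in># transit (\<sigma> (Suc k))"
    using adj by (auto intro: Claim_sent)
  from fairness[OF this] adj obtain k' where
    "k' \<ge> Suc k" "ev k' = Some (Claim i j (claim (\<sigma> (Suc k)) i))" by auto
  then show ?thesis using k by (meson Suc_leD order_trans)
qed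

text \<open>Channels may reorder messages, so the stored value lags behind until every outdated message
  has been delivered; as an edge is never silent, a current one is delivered after that.\<close>

lemma stored_claim_eventually:
  assumes adj: "adjacent P i j" and conv: "\<forall>\<^sub>F n in sequentially. claim (\<sigma> n) i \<in> S"
  shows "\<forall>\<^sub>F n in sequentially. claims (\<sigma> n) j i \<in> S"
proof -
  obtain n0 where n0: "\<And>n. n \<ge> n0 \<Longrightarrow> claim (\<sigma> n) i \<in> S"
    using conv unfolding eventually_sequentially by auto
  \<comment> \<open>These are the outdated claims on the edge; from \<open>n0\<close> on no new one
    is sent.\<close>
  define B where "B m \<longleftrightarrow> (\<exists>v. m = Claim i j v \<and> v \<notin> S)" for m :: "('r, 'd) message"
  have none: "filter_mset B (claim_messages P i' v) = {#}" if "i' = i \<Longrightarrow> v \<in> S" for i' v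
    using that by (auto simp: filter_mset_eq_mempty_iff B_def claim_messages_def)
  have none': "filter_mset B (offer_messages P j' v) = {#}" for j' v
    by (auto simp: filter_mset_eq_mempty_iff B_def offer_messages_def)
  have "\<forall>\<^sub>F n in sequentially. \<forall>m\<in>#transit (\<sigma> n). \<not> B m"
  proof (rule eventually_delivered[where ev = ev])
    fix n assume n: "n \<ge> n0"
    show "case ev n of
        None \<Rightarrow> filter_mset B (transit (\<sigma> (Suc n))) = filter_mset B (transit (\<sigma> n))
      | Some m \<Rightarrow> m \<in># transit (\<sigma> n) \<and>
          filter_mset B (transit (\<sigma> (Suc n))) = filter_mset B (transit (\<sigma> n) - {#m#})"
    proof (cases "ev n")
      case None
      then show ?thesis using idle by simp
    next
      case (Some m)
      have "filter_mset B (transit (\<sigma> (Suc n))) = filter_mset B (transit (\<sigma> n) - {#m#})"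
      proof (cases m)
        case (Claim i' j' v)
        then show ?thesis
          using Some transit_receive_Claim none' by (metis filter_union_mset add.right_neutral)
      next
        case (Offer j' i' v)
        have "claim (\<sigma> (Suc n)) i \<in> S" using n n0 by simp
        then show ?thesis
          using Offer Some transit_receive_Offer none by (metis filter_union_mset add.right_neutral)
      qed
      then show ?thesis using Some reception by simp
    qed
  next
    fix n m assume "m \<in># transit (\<sigma> n)" "B m"
    then show "\<exists>k\<ge>n. ev k = Some m" using fairness[of m n] adj by (auto simp: B_def)
  qed
  then obtain n1 where "\<forall>n\<ge>n1. \<forall>m\<in>#transit (\<sigma> n). \<not> B m"
    unfolding eventually_sequentially by auto
  then have n1: "v \<in> S" if "n \<ge> n1" "ev n = Some (Claim i j v)" for n v
    using reception that unfolding B_def by blast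
  \<comment> \<open>The entry itself may still be outdated when the last outdated message is gone.
    The first later reception overwrites it, and all further ones keep it in
    \<open>S\<close>.\<close>
  obtain k v where k: "k \<ge> n1" "ev k = Some (Claim i j v)"
    using Claim_received[OF adj] by blast
  have "claims (\<sigma> n) j i \<in> S" if "n \<ge> Suc k" for n
    using that
  proof (induction rule: dec_induct)
    case base
    show ?case using reception[OF k(2)] n1[OF k] by (simp add: update_offer_def Let_def)
  next
    case (step n)
    show ?case
    proof (cases "ev n")
      case None
      then show ?thesis using step idle by simp
    next
      case (Some m)
      have "v \<in> S" if "m = Claim i j v" for v using n1[of n v] Some that step k by simp
      then show ?thesis using reception[OF Some] step
        by (cases m) (auto simp: update_offer_def update_claim_def Let_def)
    qed
  qed
  then show ?thesis unfolding eventually_sequentially by blast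
qed

text \<open>The same argument with claims and offers interchanged.\<close>

lemma stored_offer_eventually:
  assumes adj: "adjacent P i j" and conv: "\<forall>\<^sub>F n in sequentially. offer (\<sigma> n) j \<in> S"
  shows "\<forall>\<^sub>F n in sequentially. offers (\<sigma> n) i j \<in> S"
proof -
  obtain n0 where n0: "\<And>n. n \<ge> n0 \<Longrightarrow> offer (\<sigma> n) j \<in> S"
    using conv unfolding eventually_sequentially by auto
  define B where "B m \<longleftrightarrow> (\<exists>v. m = Offer j i v \<and> v \<notin> S)" for m :: "('r, 'd) message"
  have none: "filter_mset B (offer_messages P j' v) = {#}" if "j' = j \<Longrightarrow> v \<in> S" for j' v
    using that by (auto simp: filter_mset_eq_mempty_iff B_def offer_messages_def)
  have none': "filter_mset B (claim_messages P i' v) = {#}" for i' v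
    by (auto simp: filter_mset_eq_mempty_iff B_def claim_messages_def)
  have "\<forall>\<^sub>F n in sequentially. \<forall>m\<in>#transit (\<sigma> n). \<not> B m"
  proof (rule eventually_delivered[where ev = ev])
    fix n assume n: "n \<ge> n0"
    show "case ev n of
        None \<Rightarrow> filter_mset B (transit (\<sigma> (Suc n))) = filter_mset B (transit (\<sigma> n))
      | Some m \<Rightarrow> m \<in># transit (\<sigma> n) \<and>
          filter_mset B (transit (\<sigma> (Suc n))) = filter_mset B (transit (\<sigma> n) - {#m#})"
    proof (cases "ev n")
      case None
      then show ?thesis using idle by simp
    next
      case (Some m)
      have "filter_mset B (transit (\<sigma> (Suc n))) = filter_mset B (transit (\<sigma> n) - {#m#})"
      proof (cases m)
        case (Offer j' i' v)
        then show ?thesis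
          using Some transit_receive_Offer none' by (metis filter_union_mset add.right_neutral)
      next
        case (Claim i' j' v)
        have "offer (\<sigma> (Suc n)) j \<in> S" using n n0 by simp
        then show ?thesis
          using Claim Some transit_receive_Claim none by (metis filter_union_mset add.right_neutral)
      qed
      then show ?thesis using Some reception by simp
    qed
  next
    fix n m assume "m \<in># transit (\<sigma> n)" "B m"
    then show "\<exists>k\<ge>n. ev k = Some m" using fairness[of m n] adj by (auto simp: B_def)
  qed
  then obtain n1 where "\<forall>n\<ge>n1. \<forall>m\<in>#transit (\<sigma> n). \<not> B m"
    unfolding eventually_sequentially by auto
  then have n1: "v \<in> S" if "n \<ge> n1" "ev n = Some (Offer j i v)" for n v
    using reception that unfolding B_def by blast
  obtain k v where k: "k \<ge> n1" "ev k = Some (Offer j i v)"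
    using Offer_received[OF adj] by blast
  have "offers (\<sigma> n) i j \<in> S" if "n \<ge> Suc k" for n
    using that
  proof (induction rule: dec_induct)
    case base
    show ?case using reception[OF k(2)] n1[OF k] by (simp add: update_claim_def Let_def)
  next
    case (step n)
    show ?case
    proof (cases "ev n")
      case None
      then show ?thesis using step idle by simp
    next
      case (Some m)
      have "v \<in> S" if "m = Offer j i v" for v using n1[of n v] Some that step k by simp
      then show ?thesis using reception[OF Some] step
        by (cases m) (auto simp: update_offer_def update_claim_def Let_def)
    qed
  qed
  then show ?thesis unfolding eventually_sequentially by blast
qed

section \<open>Convergence\<close>

definition settled :: "'d set \<Rightarrow> ('d \<Rightarrow> real) \<Rightarrow> real \<Rightarrow> bool" where
  "settled F s l \<longleftrightarrow>
     F \<subseteq> demands P \<and> 0 \<le> l \<and>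
     (\<forall>i\<in>F. \<forall>\<^sub>F n in sequentially. claim (\<sigma> n) i = s i) \<and>
     (\<forall>i\<in>F. 0 \<le> s i \<and> s i \<le> l \<and> s i \<le> magnitude P i) \<and>
     (\<forall>i\<in>F. s i = magnitude P i \<or>
        (\<exists>j\<in>resources P. i \<in> demands_at P j \<and> demands_at P j \<subseteq> F \<and>
           sum s (demands_at P j) = capacity P j \<and> (\<forall>k\<in>demands_at P j. s k \<le> s i))) \<and>
     (\<forall>i\<in>demands P - F. l \<le> magnitude P i) \<and>
     (\<forall>j\<in>resources P.
        sum s (demands_at P j \<inter> F) + real (card (demands_at P j - F)) * l \<le> capacity P j)"

lemma settled_empty: "settled {} s 0"
  using problem unfolding settled_def resource_allocation_problem_def by auto

lemma lex_max_min_if_settled_all: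
  assumes "settled (demands P) s l"
  shows "lex_max_min P s"
proof -
  have sub: "demands_at P j \<subseteq> demands P" if "j \<in> resources P" for j
    using problem that unfolding resource_allocation_problem_def by auto
  have "sum s (demands_at P j) \<le> capacity P j" if "j \<in> resources P" for j
  proof -
    have eqs: "demands_at P j \<inter> demands P = demands_at P j" "demands_at P j - demands P = {}"
      using sub[OF that] by auto
    have "sum s (demands_at P j \<inter> demands P) + real (card (demands_at P j - demands P)) * l
        \<le> capacity P j" using assms that unfolding settled_def by blast
    then show ?thesis unfolding eqs by simp
  qed
  then have "feasible P s"
    using assms unfolding feasible_def allocation_def settled_def by auto
  moreover have "s i = Max (s ` demands_at P j)"
    if "j \<in> resources P" "i \<in> demands_at P j" "\<forall>k\<in>demands_at P j. s k \<le> s i" for i j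
    using that finite_demands_at by (intro Max_eqI[symmetric]) auto
  ultimately show ?thesis
    using assms unfolding lex_max_min_def satisfied_def saturated_def settled_def
    by (metis order.refl)
qed

section \<open>Bounds on the claims of unsettled demands\<close>

lemma settled_claims_stored:
  assumes "settled F s l" and j: "j \<in> resources P"
  shows "\<forall>\<^sub>F n in sequentially. \<forall>i\<in>demands_at P j \<inter> F. claims (\<sigma> n) j i = s i"
proof (rule eventually_ball_finite)
  show "finite (demands_at P j \<inter> F)" using finite_demands_at[OF j] by simp
  show "\<forall>i\<in>demands_at P j \<inter> F. \<forall>\<^sub>F n in sequentially. claims (\<sigma> n) j i = s i"
  proof
    fix i assume i: "i \<in> demands_at P j \<inter> F"
    then have "adjacent P i j" "\<forall>\<^sub>F n in sequentially. claim (\<sigma> n) i \<in> {s i}"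
      using assms unfolding adjacent_def settled_def by auto
    from stored_claim_eventually[OF this] show "\<forall>\<^sub>F n in sequentially. claims (\<sigma> n) j i = s i"
      by simp
  qed
qed

text \<open>Once the settled claims have arrived, \<open>auctioneer_offer_ge\<close> keeps each
  offer to \<open>i\<close> at or above l however the other claims fluctuate. The claim is the
  minimum of these offers and a magnitude that is at least l.\<close>

lemma unsettled_claim_ge:
  assumes set: "settled F s l" and i: "i \<in> demands P - F"
  shows "\<forall>\<^sub>F n in sequentially. claim (\<sigma> n) i \<ge> l"
proof -
  have "\<forall>j\<in>resources_of P i. \<forall>\<^sub>F n in sequentially. offers (\<sigma> n) i j \<ge> l"
  proof
    fix j assume "j \<in> resources_of P i"
    then have adj: "adjacent P i j"
      using i problem unfolding adjacent_def resource_allocation_problem_def by blast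
    note j = adjacentD[OF adj]
    have "\<forall>\<^sub>F n in sequentially. offer (\<sigma> n) j \<in> {l..}"
      using settled_claims_stored[OF set j(2)]
    proof eventually_elim
      case (elim n)
      then have "sum (claims (\<sigma> n) j) (demands_at P j \<inter> F) = sum s (demands_at P j \<inter> F)"
        by (intro sum.cong) auto
      moreover have "demands_at P j - F \<noteq> {}" using i j by auto
      ultimately have "l \<le> auctioneer_offer P j (claims (\<sigma> n) j)"
        using set j elim unfolding settled_def by (intro auctioneer_offer_ge[where F = F]) auto
      then show ?case by (simp add: offer_eq)
    qed
    from stored_offer_eventually[OF adj this]
    show "\<forall>\<^sub>F n in sequentially. offers (\<sigma> n) i j \<ge> l" by simp
  qed
  then have "\<forall>\<^sub>F n in sequentially. \<forall>j\<in>resources_of P i. offers (\<sigma> n) i j \<ge> l"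
    using i finite_resources_of by (intro eventually_ball_finite) auto
  then show ?thesis
  proof eventually_elim
    case (elim n)
    then show ?case
      using i finite_resources_of[of i] set by (auto simp: claim_eq bidder_claim_def settled_def)
  qed
qed

text \<open>The lower bound l on unsettled claims eventually reaches auctioneer \<open>j\<close>
  too. From then on \<open>auctioneer_offer_eq\<close> pins its offer to l, which caps the claim of
  \<open>i\<close>.\<close>

lemma bottleneck_claim_le:
  assumes set: "settled F s l" and i: "i \<in> demands P - F" and adj: "adjacent P i j"
    and tight: "sum s (demands_at P j \<inter> F) + real (card (demands_at P j - F)) * l = capacity P j"
  shows "\<forall>\<^sub>F n in sequentially. claim (\<sigma> n) i \<le> l"
proof -
  note j = adjacentD[OF adj]
  have "\<forall>k\<in>demands_at P j - F. \<forall>\<^sub>F n in sequentially. claims (\<sigma> n) j k \<ge> l"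
  proof
    fix k assume k: "k \<in> demands_at P j - F"
    then have k': "k \<in> demands P - F"
      using j(2) problem unfolding resource_allocation_problem_def by auto
    then have "adjacent P k j" using k j unfolding adjacent_def by auto
    from stored_claim_eventually[OF this, of "{l..}"] unsettled_claim_ge[OF set k']
    show "\<forall>\<^sub>F n in sequentially. claims (\<sigma> n) j k \<ge> l" by simp
  qed
  then have "\<forall>\<^sub>F n in sequentially. \<forall>k\<in>demands_at P j - F. claims (\<sigma> n) j k \<ge> l"
    using j by (intro eventually_ball_finite) auto
  with settled_claims_stored[OF set j(2)]
  have "\<forall>\<^sub>F n in sequentially. offer (\<sigma> n) j \<in> {l}"
  proof eventually_elim
    case (elim n)
    then have "sum (claims (\<sigma> n) j) (demands_at P j \<inter> F) = sum s (demands_at P j \<inter> F)"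
      by (intro sum.cong) auto
    moreover have "demands_at P j - F \<noteq> {}" using i j by auto
    ultimately have "auctioneer_offer P j (claims (\<sigma> n) j) = l"
      using set j elim tight unfolding settled_def
      by (intro auctioneer_offer_eq[where F = F]) auto
    then show ?case by (simp add: offer_eq)
  qed
  from stored_offer_eventually[OF adj this] show ?thesis
  proof eventually_elim
    case (elim n)
    then show ?case using j by (auto simp: claim_eq bidder_claim_def intro!: Min_le)
  qed
qed

text \<open>The new level is the largest one that keeps the allocation feasible. It is a minimum of
  finitely many bounds, so some magnitude or capacity is attained.\<close>

lemma settled_raise:
  assumes set: "settled F s l" and ne: "F \<noteq> demands P"
  obtains l' where "settled F s l'"
    and "\<exists>i\<in>demands P - F. magnitude P i = l' \<or> (\<exists>j. adjacent P i j \<and>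
      sum s (demands_at P j \<inter> F) + real (card (demands_at P j - F)) * l' = capacity P j)"
proof -
  \<comment> \<open>Only resources with an unsettled demand limit the level; \<open>r j\<close> is
    the level at which resource \<open>j\<close> becomes saturated.\<close>
  define J where "J = {j \<in> resources P. demands_at P j - F \<noteq> {}}"
  define r where "r j = (capacity P j - sum s (demands_at P j \<inter> F)) / real (card (demands_at P j - F))"
    for j
  define L where "L = magnitude P ` (demands P - F) \<union> r ` J"
  have pos: "card (demands_at P j - F) > 0" if "j \<in> J" for j
    using that finite_demands_at by (auto simp: J_def card_gt_0_iff)
  have r: "sum s (demands_at P j \<inter> F) + real (card (demands_at P j - F)) * x \<le> capacity P j \<longleftrightarrow> x \<le> r j"
    if "j \<in> J" for j x
    using pos[OF that] by (simp add: r_def pos_le_divide_eq algebra_simps)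
  have req: "sum s (demands_at P j \<inter> F) + real (card (demands_at P j - F)) * r j = capacity P j"
    if "j \<in> J" for j
    using pos[OF that] by (simp add: r_def)
  have L: "finite L" "L \<noteq> {}"
    using problem set ne unfolding L_def J_def resource_allocation_problem_def settled_def by auto
  have "\<forall>x\<in>L. l \<le> x"
    using set r unfolding L_def J_def settled_def by blast
  then have le: "l \<le> Min L" using L by simp
  have "settled F s (Min L)"
    unfolding settled_def
  proof (intro conjI)
    show "\<forall>i\<in>demands P - F. Min L \<le> magnitude P i" using L by (auto simp: L_def)
    show "\<forall>j\<in>resources P. sum s (demands_at P j \<inter> F)
        + real (card (demands_at P j - F)) * Min L \<le> capacity P j"
    proof
      fix j assume j: "j \<in> resources P"
      show "sum s (demands_at P j \<inter> F) + real (card (demands_at P j - F)) * Min L \<le> capacity P j"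
      proof (cases "j \<in> J")
        case True
        then show ?thesis using r L by (auto simp: L_def)
      next
        case False
        then have "demands_at P j - F = {}" using j by (simp add: J_def)
        then have "card (demands_at P j - F) = 0" by (simp only: card.empty)
        moreover have "sum s (demands_at P j \<inter> F) + real (card (demands_at P j - F)) * l
            \<le> capacity P j" using set j unfolding settled_def by blast
        ultimately show ?thesis by simp
      qed
    qed
  qed (use set le in \<open>auto simp: settled_def\<close>)
  moreover have "\<exists>i\<in>demands P - F. magnitude P i = Min L \<or> (\<exists>j. adjacent P i j \<and>
      sum s (demands_at P j \<inter> F) + real (card (demands_at P j - F)) * Min L = capacity P j)"
  proof -
    have "Min L \<in> L" using L by simp
    then consider i where "i \<in> demands P - F" "magnitude P i = Min L"
      | j where "j \<in> J" "r j = Min L"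
      unfolding L_def by force
    then show ?thesis
    proof cases
      case 2
      then obtain i where "i \<in> demands_at P j - F" "j \<in> resources P" by (auto simp: J_def)
      moreover from this have "i \<in> demands P"
        using problem unfolding resource_allocation_problem_def by auto
      ultimately show ?thesis using req[OF 2(1)] 2 by (auto simp: adjacent_def)
    qed blast
  qed
  ultimately show thesis by (rule that)
qed

text \<open>After raising the level, all demands limited by it are frozen at once. Taking every
  unsettled demand of each tight resource makes that resource a bottleneck inside the new
  set.\<close>

lemma settled_extend:
  assumes set: "settled F s l" and ne: "F \<noteq> demands P"
  obtains F' s' l' where "settled F' s' l'" and "F \<subset> F'"
proof -
  obtain l where set: "settled F s l"
    and ex: "\<exists>i\<in>demands P - F. magnitude P i = l \<or> (\<exists>j. adjacent P i j \<and>
      sum s (demands_at P j \<inter> F) + real (card (demands_at P j - F)) * l = capacity P j)"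
    using settled_raise[OF set ne] .
  define tight where "tight j \<longleftrightarrow>
    sum s (demands_at P j \<inter> F) + real (card (demands_at P j - F)) * l = capacity P j" for j
  define G where "G = {i \<in> demands P - F. magnitude P i = l \<or> (\<exists>j. adjacent P i j \<and> tight j)}"
  define s' where "s' i = (if i \<in> F then s i else l)" for i
  \<comment> \<open>Freezing demands at the current level does not change the load of any
    resource.\<close>
  have sum': "sum s' (demands_at P j \<inter> (F \<union> G)) + real (card (demands_at P j - (F \<union> G))) * l =
      sum s (demands_at P j \<inter> F) + real (card (demands_at P j - F)) * l"
    if "j \<in> resources P" for j
  proof -
    let ?D = "demands_at P j"
    have fin: "finite ?D" using that by (rule finite_demands_at)
    have "sum s' (?D \<inter> (F \<union> G)) = sum s' (?D \<inter> F) + sum s' (?D \<inter> G)"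
      using fin by (subst sum.union_disjoint[symmetric]) (auto simp: G_def Int_Un_distrib)
    also have "sum s' (?D \<inter> F) = sum s (?D \<inter> F)"
      by (intro sum.cong) (auto simp: s'_def)
    also have "sum s' (?D \<inter> G) = (\<Sum>i\<in>?D \<inter> G. l)"
      by (intro sum.cong) (auto simp: s'_def G_def)
    finally have "sum s' (?D \<inter> (F \<union> G)) = sum s (?D \<inter> F) + real (card (?D \<inter> G)) * l" by simp
    moreover have "card (?D - F) = card (?D \<inter> G) + card (?D - (F \<union> G))"
      using fin by (subst card_Un_disjoint[symmetric]) (auto simp: G_def intro!: arg_cong[of _ _ card])
    ultimately show ?thesis by (simp add: algebra_simps)
  qed
  have "settled (F \<union> G) s' l"
    unfolding settled_def
  proof (intro conjI ballI)
    show "F \<union> G \<subseteq> demands P" "0 \<le> l" using set by (auto simp: settled_def G_def)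
  next
    fix i assume i: "i \<in> F \<union> G"
    show "\<forall>\<^sub>F n in sequentially. claim (\<sigma> n) i = s' i"
    proof (cases "i \<in> F")
      case True
      then show ?thesis using set by (simp add: settled_def s'_def)
    next
      case False
      then have iG: "i \<in> demands P - F" "magnitude P i = l \<or> (\<exists>j. adjacent P i j \<and> tight j)"
        using i by (auto simp: G_def)
      have "\<forall>\<^sub>F n in sequentially. claim (\<sigma> n) i \<le> l"
        using iG(2)
      proof
        assume "magnitude P i = l"
        then show ?thesis using iG(1) finite_resources_of[of i]
          by (auto simp: claim_eq bidder_claim_def)
      next
        assume "\<exists>j. adjacent P i j \<and> tight j"
        then show ?thesis using bottleneck_claim_le[OF set iG(1)] by (auto simp: tight_def)
      qed
      with unsettled_claim_ge[OF set iG(1)] show ?thesis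
        by eventually_elim (use False in \<open>auto simp: s'_def\<close>)
    qed
    show "0 \<le> s' i" "s' i \<le> l" "s' i \<le> magnitude P i"
      using i set by (auto simp: s'_def G_def settled_def)
    show "s' i = magnitude P i \<or>
        (\<exists>j\<in>resources P. i \<in> demands_at P j \<and> demands_at P j \<subseteq> F \<union> G \<and>
           sum s' (demands_at P j) = capacity P j \<and> (\<forall>k\<in>demands_at P j. s' k \<le> s' i))"
    proof (cases "i \<in> F")
      case True
      then consider "s i = magnitude P i" | j where "j \<in> resources P" "i \<in> demands_at P j"
        "demands_at P j \<subseteq> F" "sum s (demands_at P j) = capacity P j"
        "\<forall>k\<in>demands_at P j. s k \<le> s i"
        using set unfolding settled_def by blast
      then show ?thesis
      proof cases
        case 2
        then have "sum s' (demands_at P j) = sum s (demands_at P j)"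
          by (intro sum.cong) (auto simp: s'_def)
        then have "i \<in> demands_at P j \<and> demands_at P j \<subseteq> F \<union> G \<and>
           sum s' (demands_at P j) = capacity P j \<and> (\<forall>k\<in>demands_at P j. s' k \<le> s' i)"
          using 2 by (auto simp: s'_def)
        then show ?thesis using 2(1) by blast
      qed (use True in \<open>simp add: s'_def\<close>)
    next
      case False
      then have "magnitude P i = l \<or> (\<exists>j. adjacent P i j \<and> tight j)" and s'i: "s' i = l"
        using i by (auto simp: G_def s'_def)
      then consider "magnitude P i = l" | j where "adjacent P i j" "tight j" by blast
      then show ?thesis
      proof cases
        case 2
        note j = adjacentD[OF 2(1)]
        have "k \<in> F \<union> G" if "k \<in> demands_at P j" for k
        proof -
          have "k \<in> demands P"
            using that j problem unfolding resource_allocation_problem_def by auto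
          then show ?thesis using that j 2 unfolding G_def adjacent_def by blast
        qed
        then have sub: "demands_at P j \<subseteq> F \<union> G" by blast
        then have eqs: "demands_at P j \<inter> (F \<union> G) = demands_at P j" "demands_at P j - (F \<union> G) = {}"
          by auto
        then have "sum s' (demands_at P j) = capacity P j"
          using sum'[OF j(2)] 2(2) unfolding tight_def eqs by simp
        moreover have "\<forall>k\<in>demands_at P j. s' k \<le> s' i"
          using set s'i by (auto simp: s'_def settled_def)
        ultimately show ?thesis using j sub by blast
      qed (simp add: s'i)
    qed
  next
    fix i assume "i \<in> demands P - (F \<union> G)"
    then show "l \<le> magnitude P i" using set by (auto simp: settled_def)
  next
    fix j assume "j \<in> resources P"
    then show "sum s' (demands_at P j \<inter> (F \<union> G)) +
        real (card (demands_at P j - (F \<union> G))) * l \<le> capacity P j"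
      using sum' set by (simp add: settled_def)
  qed
  moreover have "F \<subset> F \<union> G" using ex unfolding G_def tight_def by blast
  ultimately show thesis by (rule that)
qed

section \<open>Completion of water filling and passage to real time\<close>

lemma settled_demands: "\<exists>s l. settled (demands P) s l"
proof -
  have fin: "finite (demands P)" using problem unfolding resource_allocation_problem_def by simp
  have "\<exists>s l. settled (demands P) s l" if "settled F s l" for F s l
    using that
  proof (induction "card (demands P - F)" arbitrary: F s l rule: less_induct)
    case less
    show ?case
    proof (cases "F = demands P")
      case False
      obtain F' s' l' where F': "settled F' s' l'" "F \<subset> F'"
        using settled_extend[OF less.prems False] .
      then have "demands P - F' \<subset> demands P - F" by (auto simp: settled_def)
      then have "card (demands P - F') < card (demands P - F)"
        using fin by (intro psubset_card_mono) auto
      then show ?thesis using less.hyps F' by blast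
    qed (use less.prems in blast)
  qed
  then show ?thesis using settled_empty by blast
qed

text \<open>By monotonicity the first \<open>n0\<close> events all have happened by time
  \<open>t n0\<close>. Finiteness of the set of events up to a given time makes its cardinality a
  true count, so the state index is at least \<open>n0\<close> from then on.\<close>

lemma state_at_eventually:
  assumes "\<forall>\<^sub>F n in sequentially. Q (\<sigma> n)"
  shows "\<exists>T. \<forall>T'\<ge>T. Q (state_at \<sigma> t T')"
proof -
  obtain n0 where n0: "\<And>n. n \<ge> n0 \<Longrightarrow> Q (\<sigma> n)"
    using assms unfolding eventually_sequentially by blast
  have "card {n. t n \<le> T'} \<ge> n0" if "T' \<ge> t n0" for T'
  proof -
    have "mono t" "finite {n. t n \<le> T'}" using execution unfolding execution_def by blast+
    moreover from this(1) have "{..<n0} \<subseteq> {n. t n \<le> T'}"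
      using that by (auto dest!: monoD[of t _ n0] less_imp_le)
    ultimately have "card {..<n0} \<le> card {n. t n \<le> T'}" by (intro card_mono)
    then show ?thesis by simp
  qed
  then show ?thesis using n0 unfolding state_at_def by blast
qed

theorem claims_converge:
  "\<exists>T s. (\<forall>T'\<ge>T. \<forall>i\<in>demands P. claim (state_at \<sigma> t T') i = s i) \<and> lex_max_min P s"
proof -
  obtain s l where s: "settled (demands P) s l" using settled_demands by blast
  have "finite (demands P)" using problem unfolding resource_allocation_problem_def by simp
  then have "\<forall>\<^sub>F n in sequentially. \<forall>i\<in>demands P. claim (\<sigma> n) i = s i"
    using s unfolding settled_def by (intro eventually_ball_finite) auto
  from state_at_eventually[OF this] lex_max_min_if_settled_all[OF s] show ?thesis by blast
qed

end

theorem theorem1: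
  fixes N M :: nat
    and P :: "(nat, nat) problem"
    and \<sigma> :: "nat \<Rightarrow> (nat, nat) state"
    and ev :: "nat \<Rightarrow> (nat, nat) message option"
    and t :: "nat \<Rightarrow> real"
  assumes "resources P = {1..N}"
    and "demands P = {1..M}"
    and "resource_allocation_problem P"
    and "execution P \<sigma> ev t"
  shows "\<exists>T s. (\<forall>T'\<ge>T. \<forall>i\<in>demands P. claim (state_at \<sigma> t T') i = s i) \<and> lex_max_min P s"
proof -
  interpret react_execution P \<sigma> ev t using assms(3,4) by unfold_locales
  show ?thesis by (rule claims_converge)
qed

end
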